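(* Let $v_t$ be the soft-value functions of the pretrained process $p^{\mathrm{pre}}$ with reward $r:\mathcal X\to[-B,B]$, let $\hat v_t:\mathcal X\to[-B,B]$ ($t=0,\dots,T$) be estimates of them, and let $p^*(x_0)$ and $\hat p(x_0)$ be the laws of $x_0$ under the aligned process $p^*$ (tilted by $v_t$) and the estimated aligned process $\hat p$ (tilted by $\hat v_t$), respectively. Then $$d_{TV}\left(\hat p(x_0),p^*(x_0)\right)\le \frac{e^{2B}}{2}\sqrt{\sum_{t=0}^{T}\|\hat v_t-v_t\|^2_{L^2(p^{\mathrm{pre}}_t)}}.$$
   Context: Let $\mathcal X$ be a (continuous or discrete) state space and $T\ge 1$. The pretrained model is a Markov process $x_T\to x_{T-1}\to\dots\to x_0$ on $\mathcal X$ given by an initial distribution $p^{\mathrm{pre}}_T(x_T)$ and transition kernels $p^{\mathrm{pre}}_t(x_t\mid x_{t+1})$, $t=0,\dots,T-1$; $p^{\mathrm{pre}}_t$ also denotes the marginal law of $x_t$. The reward is $r:\mathcal X\to[-B,B]$. The soft-value functions are $v_t(x_t)=\log \mathbb E_{x_0\sim p^{\mathrm{pre}}(\cdot\mid x_t)}[e^{r(x_0)}]$ for $0\le t\le T$ (so $v_0=r$), and $v_{T+1}=\log\mathbb E_{x_0\sim p^{\mathrm{pre}}}[e^{r(x_0)}]$ is a constant. The aligned process $p^*$ is the Markov process with $p^*_T(x_T)=e^{v_T(x_T)-v_{T+1}}p^{\mathrm{pre}}_T(x_T)$ and $p^*_t(x_t\mid x_{t+1})=e^{v_t(x_t)-v_{t+1}(x_{t+1})}p^{\mathrm{pre}}_t(x_t\mid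 x_{t+1})$; its $x_0$-marginal is $p^*(x_0)\propto e^{r(x_0)}p^{\mathrm{pre}}(x_0)$. The estimated process $\hat p$ is the Markov process with $\hat p_T(x_T)\propto e^{\hat v_T(x_T)}p^{\mathrm{pre}}_T(x_T)$ and $\hat p_t(x_t\mid x_{t+1})\propto e^{\hat v_t(x_t)}p^{\mathrm{pre}}_t(x_t\mid x_{t+1})$ (normalized in $x_t$). $d_{TV}(P,Q)=\sup_A|P(A)-Q(A)|$. *)

theory Defs
  imports "HOL-Probability.Probability"
begin

text \<open>
  A finite-horizon Markov process \<open>x\<^sub>T \<rightarrow> \<dots> \<rightarrow> x\<^sub>0\<close> on a measurable space is given by the law
  \<open>\<mu>\<close> of \<open>x\<^sub>T\<close> and kernels \<open>K\<close>, where \<open>K t x\<close> is the law of \<open>x\<^sub>t\<close> given \<open>x\<^sub>t\<^sub>+\<^sub>1 = x\<close>.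
  Time runs downwards, and only \<open>K t\<close> with \<open>t < T\<close> is ever used.
\<close>

type_synonym 'a kernels = "nat \<Rightarrow> 'a \<Rightarrow> 'a measure"

text \<open>\<open>marginal T \<mu> K t\<close> is the law of \<open>x\<^sub>t\<close>; only \<open>t \<le> T\<close> is meaningful.\<close>

function marginal :: "nat \<Rightarrow> 'a measure \<Rightarrow> 'a kernels \<Rightarrow> nat \<Rightarrow> 'a measure" where
  "marginal T \<mu> K t = (if t < T then marginal T \<mu> K (Suc t) \<bind> K t else \<mu>)"
  by auto
termination
  by (relation "Wellfounded.measure (\<lambda>(T, _, _, t). T - t)") auto

declare marginal.simps [simp del]

text \<open>The conditional law of \<open>x\<^sub>0\<close> given \<open>x\<^sub>t = x\<close>.\<close>

primrec cond_law0 :: "'a measure \<Rightarrow> 'a kernels \<Rightarrow> nat \<Rightarrow> 'a \<Rightarrow> 'a measure" where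
  "cond_law0 M K 0 x = return M x"
| "cond_law0 M K (Suc t) x = K t x \<bind> cond_law0 M K t"

definition soft_value :: "'a measure \<Rightarrow> 'a kernels \<Rightarrow> ('a \<Rightarrow> real) \<Rightarrow> nat \<Rightarrow> 'a \<Rightarrow> real" where
  "soft_value M K r t x = ln (\<integral>y. exp (r y) \<partial>cond_law0 M K t x)"

text \<open>The constant \<open>v\<^sub>T\<^sub>+\<^sub>1\<close>.\<close>

definition soft_value_const :: "nat \<Rightarrow> 'a measure \<Rightarrow> 'a kernels \<Rightarrow> ('a \<Rightarrow> real) \<Rightarrow> real" where
  "soft_value_const T \<mu> K r = ln (\<integral>y. exp (r y) \<partial>marginal T \<mu> K 0)"

definition aligned_init :: 
    "'a measure \<Rightarrow> nat \<Rightarrow> 'a measure \<Rightarrow> 'a kernels \<Rightarrow> ('a \<Rightarrow> real) \<Rightarrow> 'a measure" where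
  "aligned_init M T \<mu> K r =
     density \<mu> (\<lambda>x. ennreal (exp (soft_value M K r T x - soft_value_const T \<mu> K r)))"

definition aligned_kernel :: "'a measure \<Rightarrow> 'a kernels \<Rightarrow> ('a \<Rightarrow> real) \<Rightarrow> 'a kernels" where
  "aligned_kernel M K r t x =
     density (K t x) (\<lambda>y. ennreal (exp (soft_value M K r t y - soft_value M K r (Suc t) x)))"

text \<open>
  The probability measure proportional to \<open>exp f\<close> times \<open>N\<close>; the normalization of the
  estimated process is done separately at every step and for every conditioning state.
\<close>

definition tilt :: "'a measure \<Rightarrow> ('a \<Rightarrow> real) \<Rightarrow> 'a measure" where
  "tilt N f = density N (\<lambda>y. ennreal (exp (f y) / (\<integral>z. exp (f z) \<partial>N)))"

definition estimated_kernel :: "'a kernels \<Rightarrow> (nat \<Rightarrow> 'a \<Rightarrow> real) \<Rightarrow> 'a kernels" where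
  "estimated_kernel K w t x = tilt (K t x) (w t)"

definition aligned_law :: 
    "'a measure \<Rightarrow> nat \<Rightarrow> 'a measure \<Rightarrow> 'a kernels \<Rightarrow> ('a \<Rightarrow> real) \<Rightarrow> nat \<Rightarrow> 'a measure" where
  "aligned_law M T \<mu> K r = marginal T (aligned_init M T \<mu> K r) (aligned_kernel M K r)"

definition estimated_law ::
    "nat \<Rightarrow> 'a measure \<Rightarrow> 'a kernels \<Rightarrow> (nat \<Rightarrow> 'a \<Rightarrow> real) \<Rightarrow> nat \<Rightarrow> 'a measure" where
  "estimated_law T \<mu> K w = marginal T (tilt \<mu> (w T)) (estimated_kernel K w)"

text \<open>Meaningful for probability measures on the same \<open>\<sigma>\<close>-algebra.\<close>

definition tv_dist :: "'a measure \<Rightarrow> 'a measure \<Rightarrow> real" where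
  "tv_dist P Q = (SUP A\<in>sets P. \<bar>measure P A - measure Q A\<bar>)"

definition L2_norm :: "'a measure \<Rightarrow> ('a \<Rightarrow> real) \<Rightarrow> real" where
  "L2_norm N f = sqrt (\<integral>x. (f x)\<^sup>2 \<partial>N)"

end

(*
  The relative entropy of the aligned against the estimated process is at most the sum over t of
  the expected relative entropies of the kernels. For the tilts of a law N by v and w, which lie in
  [-B, B], the inequalities of Jensen and ln y <= y - 1 and a second-order expansion of exp bound it
  by exp (2 B) / 2 * |w - v|^2 in L2(N). The aligned marginals have density
  exp (v_t - v_(T+1)) <= exp (2 B) with respect to the pretrained ones, which replaces the aligned by
  the pretrained marginals at the cost of another factor exp (2 B), and Pinsker's inequality concludes.
*)

theory Submission
  imports Defs
begin

subsection \<open>Bounded integrands and Markov kernels\<close>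

text \<open>The chain rule averages the one-step entropies under the first argument of the entropy.
  This is why the aligned process stands there: its weights telescope, so its density at any time is
  a quotient of two quantities in \<open>[exp (- B), exp B]\<close>. The normalizers of the
  estimated process depend on the conditioning state and do not cancel; multiplying their one-step
  bounds would cost a factor exponential in \<open>T\<close>. The soft Bellman equation shows that
  the aligned kernels are normalized tilts as well, so every step compares two tilts of one and the
  same pretrained law. In the one-step factor \<open>exp (2 * B)\<close>, one \<open>exp B\<close>
  bounds the second derivative of \<open>exp\<close> on \<open>[-B, B]\<close> and the other bounds
  the inverse normalizer.\<close>

text \<open>Taylor's formula with the second derivative bounded by \<open>exp c\<close>. The
  Maclaurin remainder point \<open>t\<close> comes only with a bound on its absolute value: for
  \<open>a \<le> b\<close> this still gives \<open>a + t \<le> b \<le> c\<close>, but for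
  \<open>b < a\<close> it would allow \<open>a + t > a\<close>, so that case is handled by a direct
  estimate of \<open>exp (- d)\<close>.\<close>

lemma exp_remainder_le:
  fixes a b c :: real
  assumes "a \<le> c" "b \<le> c"
  shows "exp b - exp a - (b - a) * exp a \<le> exp c / 2 * (b - a)\<^sup>2"
proof (cases "a \<le> b")
  case True
  obtain t where t: "\<bar>t\<bar> \<le> \<bar>b - a\<bar>"
    "exp (b - a) = (\<Sum>m<2. (b - a) ^ m / fact m) + exp t / fact 2 * (b - a) ^ 2"
    using Maclaurin_exp_le[of "b - a" 2] by auto
  have "exp b - exp a - (b - a) * exp a = exp a * (exp (b - a) - 1 - (b - a))"
    by (simp add: exp_diff field_simps)
  also have "\<dots> = exp (a + t) / 2 * (b - a)\<^sup>2"
    unfolding t(2) by (simp add: exp_add numeral_2_eq_2)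
  also have "\<dots> \<le> exp c / 2 * (b - a)\<^sup>2"
    using t(1) True assms by (intro mult_right_mono) auto
  finally show ?thesis .
next
  case False
  define d where "d = a - b"
  have d: "d > 0" using False by (simp add: d_def)
  have pos: "0 < 1 + d + d\<^sup>2 / 2"
    using d by (simp add: add_pos_nonneg)
  \<comment> \<open>The product equals \<open>1 + d ^ 4 / 4\<close>, so the second factor dominates
    the inverse of the Taylor polynomial of \<open>exp d\<close>.\<close>
  have "1 \<le> (1 + d + d\<^sup>2 / 2) * (1 - d + d\<^sup>2 / 2)"
    using d by (simp add: algebra_simps power2_eq_square)
  also have "\<dots> \<le> exp d * (1 - d + d\<^sup>2 / 2)"
  proof (intro mult_right_mono exp_lower_Taylor_quadratic)
    have "0 \<le> (1 - d)\<^sup>2" by simp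
    thus "0 \<le> 1 - d + d\<^sup>2 / 2" by (simp add: power2_eq_square algebra_simps)
  qed (use d in auto)
  finally have "exp (- d) \<le> 1 - d + d\<^sup>2 / 2"
    by (simp add: exp_minus field_simps)
  moreover have "0 \<le> exp (- d) - 1 + d"
    using exp_ge_add_one_self[of "- d"] by linarith
  ultimately have "exp a * (exp (- d) - 1 + d) \<le> exp c * (d\<^sup>2 / 2)"
    using assms by (intro mult_mono) auto
  moreover have "exp b - exp a - (b - a) * exp a = exp a * (exp (- d) - 1 + d)"
    by (simp add: d_def exp_diff field_simps)
  ultimately show ?thesis by (simp add: d_def power2_commute)
qed

lemma abs_ln_le:
  fixes x :: real
  assumes "exp (- C) \<le> x" "x \<le> exp C"
  shows "\<bar>ln x\<bar> \<le> C"
proof -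
  have "0 < x" using assms(1) exp_gt_zero[of "- C"] by linarith
  thus ?thesis using assms by (metis abs_leI ln_exp ln_ge_iff ln_mono minus_le_iff)
qed

lemma (in prob_space) integrable_bounded:
  fixes f :: "'a \<Rightarrow> real"
  assumes "f \<in> borel_measurable M" "\<And>x. x \<in> space M \<Longrightarrow> \<bar>f x\<bar> \<le> C"
  shows "integrable M f"
  using assms by (intro integrable_const_bound[where B = C] AE_I2) auto

lemma (in prob_space) abs_integral_le:
  fixes f :: "'a \<Rightarrow> real"
  assumes "f \<in> borel_measurable M" "\<And>x. x \<in> space M \<Longrightarrow> \<bar>f x\<bar> \<le> C"
  shows "\<bar>\<integral>x. f x \<partial>M\<bar> \<le> C"
proof -
  note i = integrable_bounded[OF assms]
  have "-C \<le> (\<integral>x. f x \<partial>M)" "(\<integral>x. f x \<partial>M) \<le> C"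
    using i assms(2) by (auto intro!: integral_ge_const integral_le_const AE_I2 simp: abs_le_iff minus_le_iff)
  thus ?thesis by (simp add: abs_le_iff)
qed

lemma (in prob_space) integral_exp_bounds:
  fixes f :: "'a \<Rightarrow> real"
  assumes "f \<in> borel_measurable M" "\<And>x. x \<in> space M \<Longrightarrow> \<bar>f x\<bar> \<le> C"
  shows "integrable M (\<lambda>x. exp (f x))"
    and "exp (- C) \<le> (\<integral>x. exp (f x) \<partial>M)" and "(\<integral>x. exp (f x) \<partial>M) \<le> exp C"
    and "0 < (\<integral>x. exp (f x) \<partial>M)"
proof -
  have b: "- C \<le> f x" "f x \<le> C" if "x \<in> space M" for x
    using assms(2)[OF that] by auto
  show i: "integrable M (\<lambda>x. exp (f x))"
    using assms b by (intro integrable_bounded[where C = "exp C"]) auto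
  show l: "exp (- C) \<le> (\<integral>x. exp (f x) \<partial>M)" and "(\<integral>x. exp (f x) \<partial>M) \<le> exp C"
    using i b by (auto intro!: integral_ge_const integral_le_const AE_I2)
  show "0 < (\<integral>x. exp (f x) \<partial>M)" using l exp_gt_zero[of "-C"] by linarith
qed

lemma prob_algebraD:
  assumes "P \<in> space (prob_algebra M)"
  shows "prob_space P" "sets P = sets M" "space P = space M"
  using assms by (auto simp: space_prob_algebra dest: sets_eq_imp_space_eq)

lemma kernelD:
  assumes "K \<in> M \<rightarrow>\<^sub>M prob_algebra N" "x \<in> space M"
  shows "prob_space (K x)" "sets (K x) = sets N" "space (K x) = space N"
  using prob_algebraD[OF measurable_space[OF assms]] by auto

lemma bind_in_prob_algebra:
  assumes "P \<in> space (prob_algebra M)" "K \<in> M \<rightarrow>\<^sub>M prob_algebra N"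
  shows "P \<bind> K \<in> space (prob_algebra N)"
  using prob_space_bind'[OF assms] sets_bind'[OF assms] by (simp add: space_prob_algebra)

lemma measurable_kernel_integral:
  fixes f :: "'b \<Rightarrow> real"
  assumes "K \<in> M \<rightarrow>\<^sub>M prob_algebra N" "f \<in> borel_measurable N"
  shows "(\<lambda>x. \<integral>y. f y \<partial>K x) \<in> borel_measurable M"
  using measurable_compose[OF measurable_prob_algebraD[OF assms(1)]
      integral_measurable_subprob_algebra[OF assms(2)]] .

lemma kernel_measurable_nn_integral:
  assumes "K \<in> M \<rightarrow>\<^sub>M prob_algebra N" "(\<lambda>(x, y). f x y) \<in> borel_measurable (M \<Otimes>\<^sub>M N)"
  shows "(\<lambda>x. \<integral>\<^sup>+y. f x y \<partial>K x) \<in> borel_measurable M"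
  using nn_integral_measurable_subprob_algebra2[OF assms(2) measurable_prob_algebraD[OF assms(1)]] .

lemma nn_integral_bind_kernel:
  assumes "P \<in> space (prob_algebra M)" "K \<in> M \<rightarrow>\<^sub>M prob_algebra N" "f \<in> borel_measurable N"
  shows "(\<integral>\<^sup>+y. f y \<partial>(P \<bind> K)) = (\<integral>\<^sup>+x. \<integral>\<^sup>+y. f y \<partial>K x \<partial>P)"
proof (rule nn_integral_bind[OF assms(3)])
  show "K \<in> P \<rightarrow>\<^sub>M subprob_algebra N"
    using measurable_prob_algebraD[OF assms(2)] prob_algebraD(2)[OF assms(1)]
    by (simp cong: measurable_cong_sets)
qed

text \<open>Tower property for Bochner integrals; the uniform bound on \<open>f\<close> supplies all
  integrability, the kernels having mass 1.\<close>

lemma integral_bind_kernel: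
  fixes f :: "'b \<Rightarrow> real"
  assumes P: "P \<in> space (prob_algebra M)" and K: "K \<in> M \<rightarrow>\<^sub>M prob_algebra N"
    and f: "f \<in> borel_measurable N" "\<And>y. y \<in> space N \<Longrightarrow> \<bar>f y\<bar> \<le> C"
  shows "(\<integral>y. f y \<partial>(P \<bind> K)) = (\<integral>x. \<integral>y. f y \<partial>K x \<partial>P)"
proof -
  interpret prob_space P using prob_algebraD(1)[OF P] .
  have K': "K \<in> P \<rightarrow>\<^sub>M subprob_algebra N"
    using measurable_prob_algebraD[OF K] prob_algebraD(2)[OF P]
    by (simp cong: measurable_cong_sets)
  have "emeasure (K x) (space (K x)) \<le> ennreal 1" if "x \<in> space P" for x
    using kernelD(1)[OF K] that prob_algebraD(3)[OF P] by (simp add: prob_space.emeasure_space_1)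
  hence "AE x in P. emeasure (K x) (space (K x)) \<le> ennreal 1" by (rule AE_I2)
  thus ?thesis
    using f K' by (intro integral_bind[where K = N and B' = 1 and B = C]) (auto intro: finite_measure_axioms)
qed

subsection \<open>Exponential tilting\<close>

text \<open>The bound on \<open>f\<close> keeps the normalizer in \<open>[exp (- C), exp C]\<close>,
  so the division in \<open>tilt\<close> is genuine. The formula for \<open>g\<close> asks only for
  measurability: if one side is not integrable, neither is the other, and both take the default
  value 0.\<close>

lemma
  assumes N: "prob_space N" and f: "f \<in> borel_measurable N" "\<And>x. x \<in> space N \<Longrightarrow> \<bar>f x\<bar> \<le> C"
  shows prob_space_tilt: "prob_space (tilt N f)"
    and integral_tilt: "g \<in> borel_measurable N \<Longrightarrow>
      (\<integral>x. g x \<partial>tilt N f) = (\<integral>x. exp (f x) * g x \<partial>N) / (\<integral>x. exp (f x) \<partial>N)"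
proof -
  interpret prob_space N by fact
  note Z = integral_exp_bounds[OF f]
  show "prob_space (tilt N f)"
  proof
    have "emeasure (tilt N f) (space (tilt N f))
      = (\<integral>\<^sup>+y. ennreal (exp (f y) / (\<integral>z. exp (f z) \<partial>N)) \<partial>N)"
      unfolding tilt_def using f by (auto simp: emeasure_density intro!: nn_integral_cong)
    also have "\<dots> = ennreal (\<integral>y. exp (f y) / (\<integral>z. exp (f z) \<partial>N) \<partial>N)"
      using Z by (intro nn_integral_eq_integral) auto
    finally show "emeasure (tilt N f) (space (tilt N f)) = 1"
      using Z(4) by simp
  qed
  show "(\<integral>x. g x \<partial>tilt N f) = (\<integral>x. exp (f x) * g x \<partial>N) / (\<integral>x. exp (f x) \<partial>N)"
    if "g \<in> borel_measurable N"
    unfolding tilt_def using f that Z(4)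
    by (subst integral_density) (auto simp: intro!: AE_I2)
qed

lemma sets_tilt [simp]: "sets (tilt N f) = sets N" and space_tilt [simp]: "space (tilt N f) = space N"
  by (simp_all add: tilt_def)

lemma tilt_in_prob_algebra:
  assumes "P \<in> space (prob_algebra M)"
    and "f \<in> borel_measurable M" "\<And>x. x \<in> space M \<Longrightarrow> \<bar>f x\<bar> \<le> C"
  shows "tilt P f \<in> space (prob_algebra M)"
  using assms prob_algebraD[OF assms(1)]
  by (auto simp: space_prob_algebra intro!: prob_space_tilt[where C = C] cong: measurable_cong_sets)

text \<open>The normalizer varies with the conditioning state, so the tilted mass of a set is the
  integral of a function of both \<open>x\<close> and \<open>y\<close>. Its measurability in
  \<open>x\<close> follows from joint measurability, once the normalizer is known to be
  measurable.\<close>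

lemma tilt_kernel:
  assumes K: "K \<in> M \<rightarrow>\<^sub>M prob_algebra N"
    and f: "f \<in> borel_measurable N" "\<And>x. x \<in> space N \<Longrightarrow> \<bar>f x\<bar> \<le> C"
  shows "(\<lambda>x. tilt (K x) f) \<in> M \<rightarrow>\<^sub>M prob_algebra N"
proof (rule measurable_prob_algebraI)
  note KD = kernelD[OF K]
  have fK: "f \<in> borel_measurable (K x)" if "x \<in> space M" for x
    using f(1) KD(2)[OF that] by (simp cong: measurable_cong_sets)
  show P: "prob_space (tilt (K x) f)" if "x \<in> space M" for x
    using fK[OF that] f KD[OF that] by (intro prob_space_tilt[where C = C]) auto
  show "(\<lambda>x. tilt (K x) f) \<in> M \<rightarrow>\<^sub>M subprob_algebra N"
  proof (rule measurable_subprob_algebra)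
    show "subprob_space (tilt (K x) f)" if "x \<in> space M" for x
      using P[OF that] by (rule prob_space_imp_subprob_space)
    show "sets (tilt (K x) f) = sets N" if "x \<in> space M" for x
      using KD(2)[OF that] by simp
    fix A assume A[measurable]: "A \<in> sets N"
    have [measurable]: "f \<in> borel_measurable N" by fact
    have [measurable]: "(\<lambda>x. \<integral>z. exp (f z) \<partial>K x) \<in> borel_measurable M"
      by (rule measurable_kernel_integral[OF K]) measurable
    have "(\<lambda>x. \<integral>\<^sup>+y. ennreal (exp (f y) / (\<integral>z. exp (f z) \<partial>K x)) * indicator A y \<partial>K x)
        \<in> borel_measurable M"
      by (rule kernel_measurable_nn_integral[OF K]) measurable
    moreover have "emeasure (tilt (K x) f) A
        = (\<integral>\<^sup>+y. ennreal (exp (f y) / (\<integral>z. exp (f z) \<partial>K x)) * indicator A y \<partial>K x)"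
      if "x \<in> space M" for x
      unfolding tilt_def using fK[OF that] KD(2)[OF that] A by (subst emeasure_density) auto
    ultimately show "(\<lambda>x. emeasure (tilt (K x) f) A) \<in> borel_measurable M"
      by (simp cong: measurable_cong)
  qed
qed

subsection \<open>Relative entropy bounds in dual form\<close>

text \<open>
  By the Donsker--Varadhan formula this says \<open>KL(P | Q) \<le> D\<close>. In the dual form the chain rule for
  kernels needs neither densities nor joint laws.
\<close>

definition relative_entropy_le :: "'a measure \<Rightarrow> 'a measure \<Rightarrow> real \<Rightarrow> bool" where
  "relative_entropy_le P Q D \<longleftrightarrow>
     (\<forall>f C. f \<in> borel_measurable P \<longrightarrow> (\<forall>x\<in>space P. \<bar>f x\<bar> \<le> C) \<longrightarrow>
       (\<integral>x. f x \<partial>P) \<le> ln (\<integral>x. exp (f x) \<partial>Q) + D)"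

lemma relative_entropy_leD:
  assumes "relative_entropy_le P Q D" "f \<in> borel_measurable P" "\<And>x. x \<in> space P \<Longrightarrow> \<bar>f x\<bar> \<le> C"
  shows "(\<integral>x. f x \<partial>P) \<le> ln (\<integral>x. exp (f x) \<partial>Q) + D"
  using assms unfolding relative_entropy_le_def by blast

lemma relative_entropy_le_mono:
  "relative_entropy_le P Q D \<Longrightarrow> D \<le> D' \<Longrightarrow> relative_entropy_le P Q D'"
  unfolding relative_entropy_le_def by (meson add_left_mono order_trans)

text \<open>In the notation of the proof, the entropy of the two tilts is
  \<open>ln (Zw / Zv) - E / Zv\<close>, the Bregman divergence of the log-normalizer. By
  \<open>ln y \<le> y - 1\<close> it is at most \<open>(Zw - Zv - E) / Zv\<close>, whose numerator
  is the integral over \<open>N\<close> of the second-order remainder of \<open>exp\<close> at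
  \<open>v\<close>.\<close>

lemma relative_entropy_le_tilt:
  assumes N: "prob_space N"
    and v: "v \<in> borel_measurable N" "\<And>x. x \<in> space N \<Longrightarrow> \<bar>v x\<bar> \<le> B"
    and w: "w \<in> borel_measurable N" "\<And>x. x \<in> space N \<Longrightarrow> \<bar>w x\<bar> \<le> B"
  shows "relative_entropy_le (tilt N v) (tilt N w) (exp (2 * B) / 2 * (\<integral>x. (w x - v x)\<^sup>2 \<partial>N))"
  unfolding relative_entropy_le_def
proof (intro allI impI)
  fix f :: "_ \<Rightarrow> real" and C assume "f \<in> borel_measurable (tilt N v)" and fb: "\<forall>x\<in>space (tilt N v). \<bar>f x\<bar> \<le> C"
  hence f[measurable]: "f \<in> borel_measurable N" by (simp add: tilt_def)
  have fb: "\<bar>f x\<bar> \<le> C" if "x \<in> space N" for x using fb that by simp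
  interpret prob_space N by fact
  interpret P: prob_space "tilt N v" by (rule prob_space_tilt[OF N v])
  note [measurable] = v(1) w(1)
  define Zv where "Zv = (\<integral>x. exp (v x) \<partial>N)"
  define Zw where "Zw = (\<integral>x. exp (w x) \<partial>N)"
  define I where "I = (\<integral>x. exp (f x + w x) \<partial>N)"
  define E where "E = (\<integral>x. (w x - v x) * exp (v x) \<partial>N)"
  note Ev = integral_exp_bounds[OF v, folded Zv_def] and Ew = integral_exp_bounds[OF w, folded Zw_def]
  have fwb: "\<bar>f x + w x\<bar> \<le> C + B" if "x \<in> space N" for x using fb[OF that] w(2)[OF that] by linarith
  have db: "\<bar>w x - v x\<bar> \<le> 2 * B" if "x \<in> space N" for x using v(2)[OF that] w(2)[OF that] by linarith
  have hb: "\<bar>f x + (w x - v x)\<bar> \<le> C + 2 * B" if "x \<in> space N" for x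
    using fb[OF that] db[OF that] by linarith
  have Ipos: "0 < I" unfolding I_def
    by (rule integral_exp_bounds(4)[where C = "C + B"]) (use fwb in auto)
  have "(\<integral>x. f x + (w x - v x) \<partial>tilt N v) = (\<integral>x. f x \<partial>tilt N v) + (\<integral>x. w x - v x \<partial>tilt N v)"
    using fb db by (intro Bochner_Integration.integral_add P.integrable_bounded[where C = C]
        P.integrable_bounded[where C = "2 * B"]) (auto simp: tilt_def)
  also have "(\<integral>x. w x - v x \<partial>tilt N v) = E / Zv"
    unfolding E_def Zv_def by (subst integral_tilt[OF N v]) (auto simp: mult.commute)
  finally have split: "(\<integral>x. f x + (w x - v x) \<partial>tilt N v) = (\<integral>x. f x \<partial>tilt N v) + E / Zv" .
  \<comment> \<open>Adding \<open>w - v\<close> to the test function turns the weight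
    \<open>exp v\<close> into \<open>exp w\<close>, so the right-hand side becomes an integral of
    \<open>exp f\<close> under the other tilt, up to the ratio of normalizers.\<close>
  have "exp (\<integral>x. f x + (w x - v x) \<partial>tilt N v) \<le> (\<integral>x. exp (f x + (w x - v x)) \<partial>tilt N v)"
  proof (rule P.jensens_inequality[where I = UNIV])
    show "integrable (tilt N v) (\<lambda>x. f x + (w x - v x))"
      by (rule P.integrable_bounded[where C = "C + 2 * B"]) (use hb in \<open>auto simp: tilt_def\<close>)
    show "integrable (tilt N v) (\<lambda>x. exp (f x + (w x - v x)))"
      by (rule P.integral_exp_bounds[where C = "C + 2 * B"]) (use hb in \<open>auto simp: tilt_def\<close>)
  qed (auto intro: exp_convex)
  also have "\<dots> = I / Zv"
    unfolding I_def Zv_def by (subst integral_tilt[OF N v]) (auto simp flip: exp_add)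
  finally have "(\<integral>x. f x \<partial>tilt N v) + E / Zv \<le> ln (I / Zv)"
    unfolding split using Ipos Ev(4) by (simp add: ln_ge_iff)
  also have "I / Zv = (I / Zw) * (Zw / Zv)" using Ew(4) by simp
  also have "ln \<dots> = ln (I / Zw) + ln (Zw / Zv)" using Ipos Ew(4) Ev(4) by (intro ln_mult_pos) auto
  also have "ln (Zw / Zv) \<le> Zw / Zv - 1" using Ew(4) Ev(4) by (intro ln_le_minus_one) auto
  finally have main: "(\<integral>x. f x \<partial>tilt N v) \<le> ln (I / Zw) + (Zw - Zv - E) / Zv"
    using Ev(4) by (simp add: diff_divide_distrib)
  have int_sq: "integrable N (\<lambda>x. (w x - v x)\<^sup>2)"
  proof (rule integrable_bounded[where C = "(2 * B)\<^sup>2"])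
    show "\<bar>(w x - v x)\<^sup>2\<bar> \<le> (2 * B)\<^sup>2" if "x \<in> space N" for x
      using db[OF that] power_mono[of "\<bar>w x - v x\<bar>" "2 * B" 2] by simp
  qed measurable
  have int_E: "integrable N (\<lambda>x. (w x - v x) * exp (v x))"
  proof (rule integrable_bounded[where C = "2 * B * exp B"])
    fix x assume x: "x \<in> space N"
    show "\<bar>(w x - v x) * exp (v x)\<bar> \<le> 2 * B * exp B"
      unfolding abs_mult using db[OF x] v(2)[OF x] by (intro mult_mono) auto
  qed measurable
  have "Zw - Zv - E = (\<integral>x. exp (w x) - exp (v x) - (w x - v x) * exp (v x) \<partial>N)"
    unfolding Zw_def Zv_def E_def using Ev(1) Ew(1) int_E by simp
  also have "\<dots> \<le> (\<integral>x. exp B / 2 * (w x - v x)\<^sup>2 \<partial>N)"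
    using Ev(1) Ew(1) int_E int_sq v(2) w(2)
    by (intro integral_mono exp_remainder_le) (auto simp: abs_le_iff)
  also have "\<dots> = exp B / 2 * (\<integral>x. (w x - v x)\<^sup>2 \<partial>N)" by simp
  finally have le: "Zw - Zv - E \<le> exp B / 2 * (\<integral>x. (w x - v x)\<^sup>2 \<partial>N)" .
  \<comment> \<open>The lower bound on \<open>Zv\<close> converts the division by \<open>Zv\<close>
    into the second factor \<open>exp B\<close>.\<close>
  have "1 \<le> exp B * Zv"
    using mult_left_mono[OF Ev(2), of "exp B"] by (simp add: mult_exp_exp)
  hence "exp B / 2 * (\<integral>x. (w x - v x)\<^sup>2 \<partial>N) * 1
      \<le> exp B / 2 * (\<integral>x. (w x - v x)\<^sup>2 \<partial>N) * (exp B * Zv)"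
    by (rule mult_left_mono) simp
  also have "\<dots> = exp (2 * B) / 2 * (\<integral>x. (w x - v x)\<^sup>2 \<partial>N) * Zv"
    using mult_exp_exp[of B B] by simp
  finally have "(Zw - Zv - E) / Zv \<le> exp (2 * B) / 2 * (\<integral>x. (w x - v x)\<^sup>2 \<partial>N)"
    using le Ev(4) by (subst pos_divide_le_eq) linarith+
  hence "(\<integral>x. f x \<partial>tilt N v) \<le> ln (I / Zw) + exp (2 * B) / 2 * (\<integral>x. (w x - v x)\<^sup>2 \<partial>N)"
    using main by linarith
  moreover have "(\<integral>x. exp (f x) \<partial>tilt N w) = I / Zw"
    unfolding I_def Zw_def by (subst integral_tilt[OF N w]) (auto simp: exp_add mult.commute)
  ultimately show "(\<integral>x. f x \<partial>tilt N v)
      \<le> ln (\<integral>x. exp (f x) \<partial>tilt N w) + exp (2 * B) / 2 * (\<integral>x. (w x - v x)\<^sup>2 \<partial>N)"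
    by simp
qed

text \<open>Chain rule and data processing in one: only functions of the new state are tested. For
  each \<open>x\<close> the kernel bound replaces the integral of \<open>f\<close> by
  \<open>g x + \<kappa> x\<close>, where \<open>g x\<close> is the log-moment of \<open>f\<close>
  under \<open>L x\<close>. This \<open>g\<close> is again a bounded test function, now for
  \<open>P\<close> and \<open>Q\<close>, and \<open>exp g\<close> integrates to the moment of
  \<open>f\<close> under \<open>Q \<bind> L\<close>.\<close>

lemma relative_entropy_le_bind:
  assumes P: "P \<in> space (prob_algebra M)" and Q: "Q \<in> space (prob_algebra M)"
    and K: "K \<in> M \<rightarrow>\<^sub>M prob_algebra N" and L: "L \<in> M \<rightarrow>\<^sub>M prob_algebra N"
    and PQ: "relative_entropy_le P Q D"
    and KL: "\<And>x. x \<in> space M \<Longrightarrow> relative_entropy_le (K x) (L x) (\<kappa> x)"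
    and \<kappa>: "\<kappa> \<in> borel_measurable M" "\<And>x. x \<in> space M \<Longrightarrow> \<bar>\<kappa> x\<bar> \<le> C\<^sub>\<kappa>"
  shows "relative_entropy_le (P \<bind> K) (Q \<bind> L) (D + (\<integral>x. \<kappa> x \<partial>P))"
  unfolding relative_entropy_le_def
proof (intro allI impI)
  fix f :: "_ \<Rightarrow> real" and C assume "f \<in> borel_measurable (P \<bind> K)" and fb: "\<forall>x\<in>space (P \<bind> K). \<bar>f x\<bar> \<le> C"
  note PD = prob_algebraD[OF P] and QD = prob_algebraD[OF Q]
  note KD = kernelD[OF K] and LD = kernelD[OF L]
  note PK = prob_algebraD[OF bind_in_prob_algebra[OF P K]]
  have f[measurable]: "f \<in> borel_measurable N"
    using \<open>f \<in> borel_measurable (P \<bind> K)\<close> PK(2) by (simp cong: measurable_cong_sets)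
  have fb: "\<bar>f x\<bar> \<le> C" if "x \<in> space N" for x using fb PK(3) that by simp
  interpret prob_space P by fact
  have fK: "f \<in> borel_measurable (K x)" and fL: "f \<in> borel_measurable (L x)" if "x \<in> space M" for x
    using f KD(2)[OF that] LD(2)[OF that] by (simp_all cong: measurable_cong_sets)
  define g where "g = (\<lambda>x. ln (\<integral>y. exp (f y) \<partial>L x))"
  have Lb: "exp (- C) \<le> (\<integral>y. exp (f y) \<partial>L x)" "(\<integral>y. exp (f y) \<partial>L x) \<le> exp C"
    "0 < (\<integral>y. exp (f y) \<partial>L x)" if "x \<in> space M" for x
    using prob_space.integral_exp_bounds[OF LD(1)[OF that] fL[OF that], of C] fb LD(3)[OF that] by auto
  have gM: "g \<in> borel_measurable M"
    unfolding g_def by (intro borel_measurable_ln measurable_kernel_integral[OF L]) measurable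
  have gb: "\<bar>g x\<bar> \<le> C" if "x \<in> space M" for x
    unfolding g_def using Lb[OF that] by (intro abs_ln_le)
  have gP: "g \<in> borel_measurable P" and \<kappa>P: "\<kappa> \<in> borel_measurable P"
    using gM \<kappa>(1) PD(2) by (simp_all cong: measurable_cong_sets)
  have gi: "integrable P g" "integrable P \<kappa>"
    using gP \<kappa>P gb \<kappa>(2) PD(3) by (auto intro: integrable_bounded)
  have "(\<integral>y. f y \<partial>(P \<bind> K)) = (\<integral>x. \<integral>y. f y \<partial>K x \<partial>P)"
    by (rule integral_bind_kernel[OF P K f fb])
  also have "\<dots> \<le> (\<integral>x. g x + \<kappa> x \<partial>P)"
  proof (rule integral_mono)
    have "(\<lambda>x. \<integral>y. f y \<partial>K x) \<in> borel_measurable P"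
      using measurable_kernel_integral[OF K f] PD(2) by (simp cong: measurable_cong_sets)
    thus "integrable P (\<lambda>x. \<integral>y. f y \<partial>K x)"
      using fb fK KD PD(3)
      by (intro integrable_bounded[where C = C]) (auto intro!: prob_space.abs_integral_le)
    show "(\<integral>y. f y \<partial>K x) \<le> g x + \<kappa> x" if "x \<in> space P" for x
      unfolding g_def using that PD(3) fK fb KD(3)
      by (intro relative_entropy_leD[OF KL, where C = C]) auto
  qed (use gi in auto)
  also have "\<dots> = (\<integral>x. g x \<partial>P) + (\<integral>x. \<kappa> x \<partial>P)" using gi by simp
  also have "(\<integral>x. g x \<partial>P) \<le> ln (\<integral>x. exp (g x) \<partial>Q) + D"
    using gP gb PD(3) by (intro relative_entropy_leD[OF PQ, where C = C]) auto
  also have "(\<integral>x. exp (g x) \<partial>Q) = (\<integral>x. \<integral>y. exp (f y) \<partial>L x \<partial>Q)"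
    using Lb(3) QD(3) by (intro Bochner_Integration.integral_cong) (auto simp: g_def)
  also have "\<dots> = (\<integral>y. exp (f y) \<partial>(Q \<bind> L))"
    by (rule integral_bind_kernel[OF Q L, symmetric, where C = "exp C"])
      (use fb in \<open>auto simp: abs_le_iff\<close>)
  finally show "(\<integral>y. f y \<partial>(P \<bind> K)) \<le> ln (\<integral>y. exp (f y) \<partial>(Q \<bind> L)) + (D + (\<integral>x. \<kappa> x \<partial>P))"
    by simp
qed

section \<open>Total variation from the dual entropy bound\<close>

text \<open>Testing with a multiple of the indicator of \<open>A\<close> reduces the claim to
  Hoeffding's bound for a Bernoulli variable.\<close>

lemma relative_entropy_le_imp_measure_diff_le:
  assumes P: "prob_space P" and Q: "prob_space Q" and sets: "sets P = sets Q"
    and PQ: "relative_entropy_le P Q D" and A: "A \<in> sets P"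
  shows "measure P A - measure Q A \<le> sqrt (D / 2)"
proof -
  interpret P: prob_space P by fact
  interpret Q: prob_space Q by fact
  define p q where "p = measure P A" and "q = measure Q A"
  have AQ: "A \<in> sets Q" using A sets by simp
  \<comment> \<open>The zero test function; this settles the case \<open>p \<le> q\<close>, where
    the choice of \<open>h\<close> below would not be positive.\<close>
  have D: "0 \<le> D"
    using relative_entropy_leD[OF PQ, of "\<lambda>_. 0" 0] Q.prob_space by simp
  show ?thesis
  proof (cases "p \<le> q")
    case True
    thus ?thesis using D real_sqrt_ge_zero[of "D / 2"] unfolding p_def q_def by linarith
  next
    case False
    \<comment> \<open>The maximizer of \<open>h * (p - q) - h\<^sup>2 / 8\<close>, with maximum
      \<open>2 * (p - q)\<^sup>2\<close>.\<close>
    define h where "h = 4 * (p - q)"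
    have h: "h > 0" using False by (simp add: h_def)
    have "(\<integral>x. exp (h * indicator A x) \<partial>Q) = (\<integral>x. 1 + (exp h - 1) * indicator A x \<partial>Q)"
      by (intro Bochner_Integration.integral_cong) (auto simp: indicator_def)
    also have "\<dots> = 1 + q * (exp h - 1)"
      using AQ Q.prob_space by (subst Bochner_Integration.integral_add)
        (auto simp: q_def Q.emeasure_eq_measure intro!: integrable_real_indicator integrable_mult_right)
    finally have mgf: "(\<integral>x. exp (h * indicator A x) \<partial>Q) = 1 + q * (exp h - 1)" .
    have "h * p \<le> ln (1 + q * (exp h - 1)) + D"
      using relative_entropy_leD[OF PQ, of "\<lambda>x. h * indicator A x" h] A h
      by (simp add: mgf p_def split: split_indicator)
    \<comment> \<open>The left-hand side is the centred log-moment generating function of a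
      Bernoulli variable with parameter \<open>q\<close>.\<close>
    moreover have "- h * q + ln (1 + q * (exp h - 1)) \<le> h\<^sup>2 / 8"
      using h by (intro Hoeffdings_lemma_aux) (auto simp: q_def)
    ultimately have "h * (p - q) \<le> h\<^sup>2 / 8 + D" by (simp add: algebra_simps)
    moreover have "h * (p - q) = 4 * (p - q)\<^sup>2" "h\<^sup>2 / 8 = 2 * (p - q)\<^sup>2"
      unfolding h_def power_mult_distrib by (simp_all add: power2_eq_square)
    ultimately have "(p - q)\<^sup>2 \<le> D / 2" by linarith
    thus ?thesis unfolding p_def q_def by (rule real_le_rsqrt)
  qed
qed

text \<open>The one-sided bound suffices, because passing to the complement of \<open>A\<close>
  reverses the sign of the difference.\<close>

lemma Pinsker:
  assumes P: "prob_space P" and Q: "prob_space Q" and sets: "sets P = sets Q"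
    and PQ: "relative_entropy_le P Q D"
  shows "tv_dist Q P \<le> sqrt (D / 2)"
  unfolding tv_dist_def
proof (rule cSUP_least)
  interpret P: prob_space P by fact
  interpret Q: prob_space Q by fact
  note le = relative_entropy_le_imp_measure_diff_le[OF assms]
  fix A assume A: "A \<in> sets Q"
  hence "measure P A - measure Q A \<le> sqrt (D / 2)"
    "measure P (space P - A) - measure Q (space P - A) \<le> sqrt (D / 2)"
    using sets by (auto intro!: le)
  thus "\<bar>measure Q A - measure P A\<bar> \<le> sqrt (D / 2)"
    using A sets sets_eq_imp_space_eq[OF sets] P.prob_compl[of A] Q.prob_compl[of A] by auto
qed auto

subsection \<open>The aligned and the estimated process\<close>

lemma marginal_last [simp]: "marginal T \<mu> K T = \<mu>"
  by (simp add: marginal.simps)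

lemma marginal_less: "t < T \<Longrightarrow> marginal T \<mu> K t = marginal T \<mu> K (Suc t) \<bind> K t"
  by (subst marginal.simps) simp

lemma marginal_in_prob_algebra:
  assumes "\<mu> \<in> space (prob_algebra M)" "\<And>t. t < T \<Longrightarrow> K t \<in> M \<rightarrow>\<^sub>M prob_algebra M" "t \<le> T"
  shows "marginal T \<mu> K t \<in> space (prob_algebra M)"
  using assms(3)
proof (induction t rule: inc_induct)
  case (step t)
  thus ?case using bind_in_prob_algebra[OF _ assms(2)] by (simp add: marginal_less)
qed (use assms(1) in simp)

locale reward_process =
  fixes M :: "'a measure" and T :: nat and \<mu> :: "'a measure" and K :: "'a kernels"
    and r :: "'a \<Rightarrow> real" and B :: real
  assumes init: "\<mu> \<in> space (prob_algebra M)"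
    and kernel: "t < T \<Longrightarrow> K t \<in> M \<rightarrow>\<^sub>M prob_algebra M"
    and reward_measurable: "r \<in> borel_measurable M"
    and reward_bound: "x \<in> space M \<Longrightarrow> \<bar>r x\<bar> \<le> B"
begin

abbreviation "v \<equiv> soft_value M K r"
abbreviation "c \<equiv> soft_value_const T \<mu> K r"
abbreviation "pre \<equiv> marginal T \<mu> K"
abbreviation "aligned \<equiv> aligned_law M T \<mu> K r"

text \<open>A space that carries a probability measure has a point, and the reward bound there fixes
  the sign of \<open>B\<close>. This permits enlarging \<open>exp (2 * B)\<close> to
  \<open>exp (4 * B)\<close> at time \<open>T\<close>.\<close>

lemma B_nonneg: "0 \<le> B"
proof -
  obtain x where "x \<in> space M"
    using prob_space.not_empty[OF prob_algebraD(1)[OF init]] prob_algebraD(3)[OF init] by auto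
  thus ?thesis using reward_bound[of x] by linarith
qed

lemma pre_in_prob_algebra: "t \<le> T \<Longrightarrow> pre t \<in> space (prob_algebra M)"
  by (rule marginal_in_prob_algebra[OF init kernel])

lemma cond_law0_kernel: "t \<le> T \<Longrightarrow> cond_law0 M K t \<in> M \<rightarrow>\<^sub>M prob_algebra M"
proof (induction t)
  case (Suc t)
  have "cond_law0 M K (Suc t) = (\<lambda>x. K t x \<bind> cond_law0 M K t)" by (simp add: fun_eq_iff)
  moreover have "(\<lambda>x. K t x \<bind> cond_law0 M K t) \<in> M \<rightarrow>\<^sub>M prob_algebra M"
    using Suc kernel[of t] by (intro measurable_bind_prob_space) auto
  ultimately show ?case by simp
next
  case 0
  have "cond_law0 M K 0 = return M" by (simp add: fun_eq_iff)
  thus ?case using measurable_return_prob_space[of M] by simp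
qed

section \<open>Regularity of the soft values and the Bellman recursion\<close>

lemma exp_reward_measurable: "(\<lambda>y. exp (r y)) \<in> borel_measurable M"
  using reward_measurable by measurable

lemma exp_reward_integral:
  assumes "P \<in> space (prob_algebra M)"
  shows "exp (- B) \<le> (\<integral>y. exp (r y) \<partial>P)" "(\<integral>y. exp (r y) \<partial>P) \<le> exp B"
    "0 < (\<integral>y. exp (r y) \<partial>P)"
proof -
  note PD = prob_algebraD[OF assms]
  have "r \<in> borel_measurable P" using reward_measurable PD(2) by (simp cong: measurable_cong_sets)
  from prob_space.integral_exp_bounds[OF PD(1) this, of B]
  show "exp (- B) \<le> (\<integral>y. exp (r y) \<partial>P)" "(\<integral>y. exp (r y) \<partial>P) \<le> exp B"
    "0 < (\<integral>y. exp (r y) \<partial>P)"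
    using reward_bound PD(3) by auto
qed

lemma exp_soft_value:
  assumes "t \<le> T" "x \<in> space M"
  shows "exp (v t x) = (\<integral>y. exp (r y) \<partial>cond_law0 M K t x)"
  unfolding soft_value_def
  using exp_reward_integral(3)[OF measurable_space[OF cond_law0_kernel[OF assms(1)] assms(2)]]
  by (rule exp_ln)

lemma abs_soft_value_le:
  assumes "t \<le> T" "x \<in> space M"
  shows "\<bar>v t x\<bar> \<le> B"
  unfolding soft_value_def
  using exp_reward_integral[OF measurable_space[OF cond_law0_kernel[OF assms(1)] assms(2)]]
  by (intro abs_ln_le)

lemma soft_value_measurable: "t \<le> T \<Longrightarrow> v t \<in> borel_measurable M"
  unfolding soft_value_def[abs_def]
  by (intro borel_measurable_ln measurable_kernel_integral[OF cond_law0_kernel]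
      exp_reward_measurable)

lemma exp_soft_value_const: "exp c = (\<integral>y. exp (r y) \<partial>pre 0)"
  unfolding soft_value_const_def
  using exp_reward_integral(3)[OF pre_in_prob_algebra] by (intro exp_ln) auto

lemma abs_soft_value_const_le: "\<bar>c\<bar> \<le> B"
  unfolding soft_value_const_def
  using exp_reward_integral[OF pre_in_prob_algebra[of 0]] by (intro abs_ln_le) auto

text \<open>Soft Bellman equation, by conditioning on the next state. It identifies the normalizer
  of \<open>tilt (K t x) (v t)\<close>, so that aligned and estimated kernels take the same
  form.\<close>

lemma soft_value_Suc:
  assumes "t < T" "x \<in> space M"
  shows "exp (v (Suc t) x) = (\<integral>y. exp (v t y) \<partial>K t x)"
proof -
  note Kt = measurable_space[OF kernel[OF assms(1)] assms(2)]
  have "exp (v (Suc t) x) = (\<integral>y. exp (r y) \<partial>(K t x \<bind> cond_law0 M K t))"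
    using assms by (simp add: exp_soft_value)
  also have "\<dots> = (\<integral>y. \<integral>z. exp (r z) \<partial>cond_law0 M K t y \<partial>K t x)"
    using assms reward_bound
    by (intro integral_bind_kernel[OF Kt cond_law0_kernel exp_reward_measurable, where C = "exp B"])
      (auto simp: abs_le_iff)
  also have "\<dots> = (\<integral>y. exp (v t y) \<partial>K t x)"
    using assms prob_algebraD(3)[OF Kt]
    by (intro Bochner_Integration.integral_cong) (auto simp: exp_soft_value)
  finally show ?thesis .
qed

text \<open>Along the pretrained process \<open>exp (v t x)\<close> is a martingale in the direction
  in which the chain runs, so its mean does not depend on \<open>t\<close>. At \<open>t = T\<close>
  this is the normalizer of the aligned initial law.\<close>

lemma integral_exp_soft_value_pre: "t \<le> T \<Longrightarrow> (\<integral>x. exp (v t x) \<partial>pre t) = exp c"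
proof (induction t)
  case 0
  have "(\<integral>x. exp (v 0 x) \<partial>pre 0) = (\<integral>x. exp (r x) \<partial>pre 0)"
  proof (rule Bochner_Integration.integral_cong[OF refl])
    fix x assume "x \<in> space (pre 0)"
    hence "x \<in> space M" using prob_algebraD(3)[OF pre_in_prob_algebra[of 0]] by simp
    thus "exp (v 0 x) = exp (r x)"
      using exp_reward_measurable by (simp add: soft_value_def integral_return)
  qed
  thus ?case by (simp add: exp_soft_value_const)
next
  case (Suc t)
  have [measurable]: "v t \<in> borel_measurable M" using Suc.prems by (intro soft_value_measurable) auto
  have "exp c = (\<integral>x. exp (v t x) \<partial>(pre (Suc t) \<bind> K t))"
    using Suc by (simp add: marginal_less)
  also have "\<dots> = (\<integral>x. \<integral>y. exp (v t y) \<partial>K t x \<partial>pre (Suc t))"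
    using Suc.prems abs_soft_value_le[of t]
    by (intro integral_bind_kernel[OF pre_in_prob_algebra kernel, where C = "exp B"])
      (auto simp: abs_le_iff)
  also have "\<dots> = (\<integral>x. exp (v (Suc t) x) \<partial>pre (Suc t))"
    using Suc.prems prob_algebraD(3)[OF pre_in_prob_algebra[of "Suc t"]]
    by (intro Bochner_Integration.integral_cong) (auto simp: soft_value_Suc)
  finally show ?case by simp
qed

section \<open>The aligned process as tilts, and the change of measure\<close>

lemma aligned_init_eq_tilt: "aligned_init M T \<mu> K r = tilt \<mu> (v T)"
  using integral_exp_soft_value_pre[of T] by (simp add: aligned_init_def tilt_def exp_diff)

lemma aligned_kernel_eq_tilt:
  "t < T \<Longrightarrow> x \<in> space M \<Longrightarrow> aligned_kernel M K r t x = tilt (K t x) (v t)"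
  by (simp add: aligned_kernel_def tilt_def exp_diff soft_value_Suc)

lemma aligned_kernel_kernel:
  assumes "t < T"
  shows "aligned_kernel M K r t \<in> M \<rightarrow>\<^sub>M prob_algebra M"
proof -
  have "(\<lambda>x. tilt (K t x) (v t)) \<in> M \<rightarrow>\<^sub>M prob_algebra M"
    using assms abs_soft_value_le[of t]
    by (intro tilt_kernel[OF kernel, where C = B] soft_value_measurable) auto
  thus ?thesis
    using aligned_kernel_eq_tilt[OF assms] by (simp cong: measurable_cong)
qed

lemma aligned_in_prob_algebra: "t \<le> T \<Longrightarrow> aligned t \<in> space (prob_algebra M)"
  unfolding aligned_law_def aligned_init_eq_tilt
  using abs_soft_value_le[of T]
  by (intro marginal_in_prob_algebra tilt_in_prob_algebra[OF init, where C = B]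
      soft_value_measurable aligned_kernel_kernel) auto

text \<open>The factors \<open>exp (v\<^sub>t - v\<^sub>t\<^sub>+\<^sub>1)\<close> of the aligned kernels telescope.\<close>

lemma aligned_eq_density: "t \<le> T \<Longrightarrow> aligned t = density (pre t) (\<lambda>x. ennreal (exp (v t x - c)))"
proof (induction t rule: inc_induct)
  case base
  show ?case by (simp add: aligned_law_def aligned_init_def)
next
  case (step t)
  note pre_t = pre_in_prob_algebra[of t] and pre_S = pre_in_prob_algebra[of "Suc t"]
  have Kt: "K t \<in> M \<rightarrow>\<^sub>M prob_algebra M" using step.hyps by (intro kernel) simp
  have [measurable]: "v t \<in> borel_measurable M" "v (Suc t) \<in> borel_measurable M"
    using step.hyps by (auto intro!: soft_value_measurable)
  have al: "aligned t = aligned (Suc t) \<bind> aligned_kernel M K r t"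
    unfolding aligned_law_def using step.hyps by (intro marginal_less) simp
  have S: "sets (pre (Suc t)) = sets M" "space (pre (Suc t)) = space M" "sets (pre t) = sets M"
    using prob_algebraD(2,3)[OF pre_S] prob_algebraD(2)[OF pre_t] step.hyps by simp_all
  have KD: "sets (K t x) = sets M" if "x \<in> space M" for x using kernelD[OF Kt that] by simp
  show ?case
  proof (rule measure_eqI)
    show "sets (aligned t) = sets (density (pre t) (\<lambda>x. ennreal (exp (v t x - c))))"
      using prob_algebraD(2) aligned_in_prob_algebra[of t] S step.hyps by simp
    fix A assume "A \<in> sets (aligned t)"
    hence A[measurable]: "A \<in> sets M"
      using prob_algebraD(2) aligned_in_prob_algebra[of t] step.hyps by auto
    \<comment> \<open>The mass of \<open>A\<close> under the aligned kernel, as an integral against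
      \<open>K t x\<close>. In this form it is measurable in \<open>x\<close>, and the weight at
      time \<open>Suc t\<close> can be moved inside, where the two occurrences of
      \<open>v (Suc t) x\<close> cancel.\<close>
    define G where "G = (\<lambda>x. \<integral>\<^sup>+y. ennreal (exp (v t y - v (Suc t) x)) * indicator A y \<partial>K t x)"
    have G[measurable]: "G \<in> borel_measurable M"
      unfolding G_def by (rule kernel_measurable_nn_integral[OF Kt]) measurable
    have "emeasure (aligned t) A = (\<integral>\<^sup>+x. emeasure (aligned_kernel M K r t x) A \<partial>aligned (Suc t))"
      unfolding al using step.hyps
      by (intro emeasure_bind_prob_algebra[OF aligned_in_prob_algebra aligned_kernel_kernel A]) auto
    also have "\<dots> = (\<integral>\<^sup>+x. G x \<partial>aligned (Suc t))"
    proof (rule nn_integral_cong)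
      fix x assume "x \<in> space (aligned (Suc t))"
      hence x: "x \<in> space M"
        using prob_algebraD(3) aligned_in_prob_algebra[of "Suc t"] step.hyps by auto
      show "emeasure (aligned_kernel M K r t x) A = G x"
        unfolding aligned_kernel_def G_def
        by (subst emeasure_density) (simp_all add: KD[OF x] cong: measurable_cong_sets)
    qed
    also have "\<dots> = (\<integral>\<^sup>+x. ennreal (exp (v (Suc t) x - c)) * G x \<partial>pre (Suc t))"
      unfolding step.IH by (subst nn_integral_density) (simp_all add: S cong: measurable_cong_sets)
    also have "\<dots> = (\<integral>\<^sup>+x. \<integral>\<^sup>+y. ennreal (exp (v t y - c)) * indicator A y \<partial>K t x \<partial>pre (Suc t))"
    proof (rule nn_integral_cong)
      fix x assume "x \<in> space (pre (Suc t))"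
      hence x: "x \<in> space M" using S by simp
      have "ennreal (exp (v (Suc t) x - c)) * G x =
        (\<integral>\<^sup>+y. ennreal (exp (v (Suc t) x - c)) *
          (ennreal (exp (v t y - v (Suc t) x)) * indicator A y) \<partial>K t x)"
        unfolding G_def
        by (subst nn_integral_cmult) (simp_all add: KD[OF x] cong: measurable_cong_sets)
      also have "\<dots> = (\<integral>\<^sup>+y. ennreal (exp (v t y - c)) * indicator A y \<partial>K t x)"
        by (intro nn_integral_cong)
          (simp add: mult.assoc[symmetric] ennreal_mult[symmetric] exp_add[symmetric])
      finally show "ennreal (exp (v (Suc t) x - c)) * G x = \<dots>" .
    qed
    also have "\<dots> = (\<integral>\<^sup>+y. ennreal (exp (v t y - c)) * indicator A y \<partial>pre t)"
      using step.hyps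
      by (simp add: marginal_less nn_integral_bind_kernel[OF pre_S Kt])
    also have "\<dots> = emeasure (density (pre t) (\<lambda>x. ennreal (exp (v t x - c)))) A"
      by (subst emeasure_density) (simp_all add: S cong: measurable_cong_sets)
    finally show "emeasure (aligned t) A = \<dots>" .
  qed
qed

text \<open>Both \<open>v t x\<close> and \<open>c\<close> lie in \<open>[-B, B]\<close>, so the
  density is at most \<open>exp (2 * B)\<close>; the sign of \<open>g\<close> carries this bound
  through the integral.\<close>

lemma integral_aligned_le:
  assumes t: "t \<le> T" and g: "g \<in> borel_measurable M" "\<And>x. x \<in> space M \<Longrightarrow> 0 \<le> g x"
    "\<And>x. x \<in> space M \<Longrightarrow> g x \<le> C"
  shows "(\<integral>x. g x \<partial>aligned t) \<le> exp (2 * B) * (\<integral>x. g x \<partial>pre t)"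
proof -
  note PD = prob_algebraD[OF pre_in_prob_algebra[OF t]]
  interpret prob_space "pre t" by (rule PD)
  have [measurable]: "g \<in> borel_measurable (pre t)" "v t \<in> borel_measurable (pre t)"
    using g(1) soft_value_measurable[OF t] PD(2) by (simp_all cong: measurable_cong_sets)
  have gi: "integrable (pre t) g"
    using g(2,3) PD(3) by (intro integrable_bounded[where C = C]) auto
  have le: "exp (v t x - c) * g x \<le> exp (2 * B) * g x" if "x \<in> space (pre t)" for x
    using abs_soft_value_le[OF t, of x] abs_soft_value_const_le that g(2) PD(3)
    by (intro mult_right_mono) (auto simp: abs_le_iff)
  have "(\<integral>x. g x \<partial>aligned t) = (\<integral>x. exp (v t x - c) * g x \<partial>pre t)"
    unfolding aligned_eq_density[OF t] by (subst integral_density) auto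
  also have "\<dots> \<le> (\<integral>x. exp (2 * B) * g x \<partial>pre t)"
    using gi le g(2) PD(3) by (intro integral_mono') auto
  finally show ?thesis by simp
qed

section \<open>Accumulation of the entropy along the chain\<close>

text \<open>The tail sum from \<open>t\<close> to \<open>T\<close> is the form that a downward
  induction can carry: passing from \<open>Suc t\<close> to \<open>t\<close> applies one more pair
  of kernels and adds exactly one term.\<close>

lemma relative_entropy_aligned_estimated:
  assumes w: "\<And>t. t \<le> T \<Longrightarrow> w t \<in> borel_measurable M"
    "\<And>t x. t \<le> T \<Longrightarrow> x \<in> space M \<Longrightarrow> \<bar>w t x\<bar> \<le> B"
  assumes t: "t \<le> T"
  shows "estimated_law T \<mu> K w t \<in> space (prob_algebra M)"
    and "relative_entropy_le (aligned t) (estimated_law T \<mu> K w t)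
      (exp (4 * B) / 2 * (\<Sum>s = t..T. \<integral>x. (w s x - v s x)\<^sup>2 \<partial>pre s))"
proof -
  have ker: "estimated_kernel K w t \<in> M \<rightarrow>\<^sub>M prob_algebra M" if "t < T" for t
    unfolding estimated_kernel_def[abs_def]
    using that w by (intro tilt_kernel[OF kernel, where C = B]) auto
  have est: "estimated_law T \<mu> K w t \<in> space (prob_algebra M)" if "t \<le> T" for t
    unfolding estimated_law_def
    using that w by (intro marginal_in_prob_algebra tilt_in_prob_algebra[OF init, where C = B] ker) auto
  show "estimated_law T \<mu> K w t \<in> space (prob_algebra M)" by (rule est[OF t])
  show "relative_entropy_le (aligned t) (estimated_law T \<mu> K w t)
      (exp (4 * B) / 2 * (\<Sum>s = t..T. \<integral>x. (w s x - v s x)\<^sup>2 \<partial>pre s))"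
    using t
  proof (induction t rule: inc_induct)
    case base
    note ID = prob_algebraD[OF init]
    have "relative_entropy_le (tilt \<mu> (v T)) (tilt \<mu> (w T))
        (exp (2 * B) / 2 * (\<integral>x. (w T x - v T x)\<^sup>2 \<partial>\<mu>))"
      using w[of T] soft_value_measurable[of T] abs_soft_value_le[of T] ID
      by (intro relative_entropy_le_tilt) (auto cong: measurable_cong_sets)
    \<comment> \<open>At time \<open>T\<close> the pretrained law already appears, so no change of
      measure takes place; the constant is enlarged only to agree with the later steps.\<close>
    moreover have "exp (2 * B) / 2 * (\<integral>x. (w T x - v T x)\<^sup>2 \<partial>\<mu>)
        \<le> exp (4 * B) / 2 * (\<integral>x. (w T x - v T x)\<^sup>2 \<partial>\<mu>)"
      using B_nonneg by (intro mult_right_mono) auto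
    ultimately show ?case
      by (auto simp: aligned_law_def estimated_law_def aligned_init_eq_tilt
          intro: relative_entropy_le_mono)
  next
    case (step t)
    define S where "S = (\<Sum>s = Suc t..T. \<integral>x. (w s x - v s x)\<^sup>2 \<partial>pre s)"
    define d where "d = (\<lambda>x. (w t x - v t x)\<^sup>2)"
    \<comment> \<open>The one-step entropy bound for the tilts of \<open>K t x\<close>, as a
      function of the state at time \<open>Suc t\<close>.\<close>
    define \<kappa> where "\<kappa> = (\<lambda>x. exp (2 * B) / 2 * (\<integral>y. d y \<partial>K t x))"
    have t: "t < T" "t \<le> T" "Suc t \<le> T" using step.hyps by auto
    note Kt = kernel[OF t(1)] and KD = kernelD[OF kernel[OF t(1)]]
    have [measurable]: "w t \<in> borel_measurable M" "v t \<in> borel_measurable M"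
      using w soft_value_measurable t by auto
    have d[measurable]: "d \<in> borel_measurable M" unfolding d_def by measurable
    have db: "0 \<le> d x" "d x \<le> (2 * B)\<^sup>2" if "x \<in> space M" for x
    proof -
      have "\<bar>w t x - v t x\<bar> \<le> 2 * B"
        using w(2)[OF t(2) that] abs_soft_value_le[OF t(2) that] by linarith
      thus "d x \<le> (2 * B)\<^sup>2"
        using power_mono[of "\<bar>w t x - v t x\<bar>" "2 * B" 2] by (simp add: d_def)
    qed (simp add: d_def)
    have dK: "0 \<le> (\<integral>y. d y \<partial>K t x)" "(\<integral>y. d y \<partial>K t x) \<le> (2 * B)\<^sup>2" if "x \<in> space M" for x
    proof -
      have "d \<in> borel_measurable (K t x)" using d KD(2)[OF that] by (simp cong: measurable_cong_sets)
      thus "(\<integral>y. d y \<partial>K t x) \<le> (2 * B)\<^sup>2"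
        using prob_space.abs_integral_le[OF KD(1)[OF that], of d "(2 * B)\<^sup>2"] db KD(3)[OF that] by auto
    qed (auto simp: d_def)
    have \<kappa>[measurable]: "\<kappa> \<in> borel_measurable M"
      unfolding \<kappa>_def using measurable_kernel_integral[OF Kt d] by measurable
    have \<kappa>b: "0 \<le> \<kappa> x" "\<kappa> x \<le> exp (2 * B) / 2 * (2 * B)\<^sup>2" if "x \<in> space M" for x
      unfolding \<kappa>_def using dK[OF that] by (auto intro!: mult_left_mono)
    have "relative_entropy_le (aligned (Suc t) \<bind> aligned_kernel M K r t)
        (estimated_law T \<mu> K w (Suc t) \<bind> estimated_kernel K w t)
        (exp (4 * B) / 2 * S + (\<integral>x. \<kappa> x \<partial>aligned (Suc t)))"
    proof (rule relative_entropy_le_bind)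
      show "relative_entropy_le (aligned_kernel M K r t x) (estimated_kernel K w t x) (\<kappa> x)"
        if x: "x \<in> space M" for x
        unfolding aligned_kernel_eq_tilt[OF t(1) x] estimated_kernel_def \<kappa>_def d_def
        using w t soft_value_measurable[of t] abs_soft_value_le[of t] KD[OF x]
        by (intro relative_entropy_le_tilt) (auto cong: measurable_cong_sets)
      show "\<bar>\<kappa> x\<bar> \<le> exp (2 * B) / 2 * (2 * B)\<^sup>2" if "x \<in> space M" for x
        using \<kappa>b[OF that] by linarith
    qed (use t step.IH in \<open>auto simp: S_def intro: aligned_in_prob_algebra est aligned_kernel_kernel ker\<close>)
    hence "relative_entropy_le (aligned t) (estimated_law T \<mu> K w t)
        (exp (4 * B) / 2 * S + (\<integral>x. \<kappa> x \<partial>aligned (Suc t)))"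
      by (simp add: aligned_law_def estimated_law_def marginal_less[OF t(1)])
    \<comment> \<open>The change of measure takes place at time \<open>Suc t\<close>, where
      \<open>\<kappa>\<close> lives. The pretrained kernel inside \<open>\<kappa>\<close> then
      carries the pretrained marginal on to time \<open>t\<close>, which is where the squared error
      is measured.\<close>
    moreover have "(\<integral>x. \<kappa> x \<partial>aligned (Suc t)) \<le> exp (4 * B) / 2 * (\<integral>x. d x \<partial>pre t)"
    proof -
      have "(\<integral>x. \<kappa> x \<partial>aligned (Suc t)) \<le> exp (2 * B) * (\<integral>x. \<kappa> x \<partial>pre (Suc t))"
        using t \<kappa>b by (intro integral_aligned_le[where C = "exp (2 * B) / 2 * (2 * B)\<^sup>2"]) auto
      also have "(\<integral>x. \<kappa> x \<partial>pre (Suc t)) = exp (2 * B) / 2 * (\<integral>x. d x \<partial>pre t)"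
        unfolding \<kappa>_def marginal_less[OF t(1)]
        by (subst integral_bind_kernel[OF pre_in_prob_algebra[OF t(3)] Kt d, where C = "(2 * B)\<^sup>2"])
          (use db in auto)
      also have "exp (2 * B) * \<dots> = exp (4 * B) / 2 * (\<integral>x. d x \<partial>pre t)"
        by (simp add: exp_add[symmetric])
      finally show ?thesis .
    qed
    moreover have "(\<Sum>s = t..T. \<integral>x. (w s x - v s x)\<^sup>2 \<partial>pre s) = (\<integral>x. d x \<partial>pre t) + S"
      unfolding S_def d_def using t(2) by (rule sum.atLeast_Suc_atMost)
    ultimately show ?case
      by (auto intro: relative_entropy_le_mono simp: algebra_simps)
  qed
qed

end

theorem theorem3p1:
  fixes M :: "'a measure" and T :: nat and \<mu> :: "'a measure"
    and K :: "nat \<Rightarrow> 'a \<Rightarrow> 'a measure"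
    and r :: "'a \<Rightarrow> real" and B :: real and vhat :: "nat \<Rightarrow> 'a \<Rightarrow> real"
  assumes "T \<ge> 1"
    and "\<mu> \<in> space (prob_algebra M)"
    and "\<And>t. t < T \<Longrightarrow> K t \<in> M \<rightarrow>\<^sub>M prob_algebra M"
    and "r \<in> borel_measurable M"
    and "\<And>x. x \<in> space M \<Longrightarrow> r x \<in> {-B..B}"
    and "\<And>t. t \<le> T \<Longrightarrow> vhat t \<in> borel_measurable M"
    and "\<And>t x. t \<le> T \<Longrightarrow> x \<in> space M \<Longrightarrow> vhat t x \<in> {-B..B}"
  shows "tv_dist (estimated_law T \<mu> K vhat 0) (aligned_law M T \<mu> K r 0)
    \<le> exp (2 * B) / 2 *
       sqrt (\<Sum>t = 0..T. (L2_norm (marginal T \<mu> K t)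
                            (\<lambda>x. vhat t x - soft_value M K r t x))\<^sup>2)"
proof -
  interpret reward_process M T \<mu> K r B
  proof
    show "\<bar>r x\<bar> \<le> B" if "x \<in> space M" for x
      using assms(5)[OF that] by (simp add: abs_le_iff minus_le_iff)
  qed (use assms(2-4) in auto)
  define S where "S = (\<Sum>t = 0..T. \<integral>x. (vhat t x - soft_value M K r t x)\<^sup>2 \<partial>marginal T \<mu> K t)"
  have w: "\<bar>vhat t x\<bar> \<le> B" if "t \<le> T" "x \<in> space M" for t x
    using assms(7)[OF that] by (simp add: abs_le_iff minus_le_iff)
  have est: "estimated_law T \<mu> K vhat 0 \<in> space (prob_algebra M)"
    and ent: "relative_entropy_le (aligned_law M T \<mu> K r 0) (estimated_law T \<mu> K vhat 0)
      (exp (4 * B) / 2 * S)"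
    unfolding S_def by (rule relative_entropy_aligned_estimated; use assms(6) w in simp)+
  have ali: "aligned_law M T \<mu> K r 0 \<in> space (prob_algebra M)"
    by (rule aligned_in_prob_algebra) simp
  have "tv_dist (estimated_law T \<mu> K vhat 0) (aligned_law M T \<mu> K r 0)
      \<le> sqrt (exp (4 * B) / 2 * S / 2)"
    using Pinsker[OF _ _ _ ent] prob_algebraD[OF est] prob_algebraD[OF ali] by simp
  \<comment> \<open>The factor 1/2 from Pinsker's inequality completes the square of
    \<open>exp (2 * B) / 2\<close>, which can then leave the root.\<close>
  also have "exp (4 * B) / 2 * S / 2 = (exp (2 * B) / 2)\<^sup>2 * S"
    by (simp add: power2_eq_square exp_add[symmetric])
  also have "sqrt \<dots> = exp (2 * B) / 2 * sqrt S"
    by (simp add: real_sqrt_mult)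
  also have "S = (\<Sum>t = 0..T. (L2_norm (marginal T \<mu> K t) (\<lambda>x. vhat t x - soft_value M K r t x))\<^sup>2)"
    by (simp add: S_def L2_norm_def)
  finally show ?thesis .
qed

end
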